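(* Let $d_A,d_B\in\mathbb{N}$ and let $P:\mathcal{M}_{d_A}\to\mathcal{M}_{d_B}$ be a linear map that is tensor-stable decomposable, i.e. $P^{\otimes n}$ is decomposable for every $n\in\mathbb{N}$. Then $P$ is completely positive or completely copositive.
   Context: $\mathbb{N}$ is the set of positive integers. $\mathcal{M}_d$ denotes the complex $d\times d$ matrices; "positive" for a matrix means positive semidefinite. $\vartheta_d:\mathcal{M}_d\to\mathcal{M}_d$ is the transposition $X\mapsto X^T$ in the computational basis. A linear map $L:\mathcal{M}_{d_A}\to\mathcal{M}_{d_B}$ is positive if it maps positive semidefinite matrices to positive semidefinite matrices; completely positive if $\mathrm{id}_k\otimes L$ is positive for all $k\in\mathbb{N}$; completely copositive if $\vartheta_k\otimes L$ is positive for all $k\in\mathbb{N}$ (equivalently $\vartheta_{d_B}\circ L$ is completely positive). $L$ is decomposable if $L=T_1+\vartheta_{d_B}\circ T_2$ for completely positive maps $T_1,T_2:\mathcal{M}_{d_A}\to\mathcal{M}_{d_B}$. $P^{\otimes n}$ is regarded as a map $\mathcal{M}_{d_A^n}\to\mathcal{M}_{d_B^n}$ via $\mathcal{M}_d^{\otimes n}\cong\mathcal{M}_{d^n}$. *)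

theory Defs
  imports "Jordan_Normal_Form.Matrix"
begin

text \<open>
  The space of complex \<open>d \<times> d\<close> matrices is \<open>carrier_mat d d :: complex mat set\<close>. A map from
  \<open>a \<times> a\<close> to \<open>b \<times> b\<close> matrices is a HOL function \<open>complex mat \<Rightarrow> complex mat\<close>; all notions below
  depend only on its values on \<open>carrier_mat a a\<close>.
\<close>

type_synonym mat_map = "complex mat \<Rightarrow> complex mat"

definition linear_mat_map :: "nat \<Rightarrow> nat \<Rightarrow> mat_map \<Rightarrow> bool" where
  "linear_mat_map a b L \<longleftrightarrow>
     (\<forall>X \<in> carrier_mat a a. L X \<in> carrier_mat b b) \<and>
     (\<forall>X \<in> carrier_mat a a. \<forall>Y \<in> carrier_mat a a. L (X + Y) = L X + L Y) \<and>
     (\<forall>c. \<forall>X \<in> carrier_mat a a. L (c \<cdot>\<^sub>m X) = c \<cdot>\<^sub>m L X)"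

text \<open>
  In the order on the complex numbers, \<open>0 \<le> z\<close> means that \<open>z\<close> is real and nonnegative; over
  the complex numbers the condition therefore forces \<open>A\<close> to be Hermitian.
\<close>

definition psd_mat :: "nat \<Rightarrow> complex mat \<Rightarrow> bool" where
  "psd_mat d A \<longleftrightarrow> A \<in> carrier_mat d d \<and> (\<forall>v \<in> carrier_vec d. 0 \<le> (A *\<^sub>v v) \<bullet>c v)"

definition positive_map :: "nat \<Rightarrow> nat \<Rightarrow> mat_map \<Rightarrow> bool" where
  "positive_map a b L \<longleftrightarrow> linear_mat_map a b L \<and> (\<forall>X. psd_mat a X \<longrightarrow> psd_mat b (L X))"

text \<open>
  The Kronecker product fixes the identification of the tensor product of two matrix algebras
  with a matrix algebra: the index pair \<open>(i, k)\<close> corresponds to \<open>i * c + k\<close>, where \<open>c\<close> is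
  the size of the second factor.
\<close>

definition kron :: "complex mat \<Rightarrow> complex mat \<Rightarrow> complex mat" where
  "kron A B = mat (dim_row A * dim_row B) (dim_col A * dim_col B)
     (\<lambda>(r, s). A $$ (r div dim_row B, s div dim_col B) * B $$ (r mod dim_row B, s mod dim_col B))"

definition matrix_unit :: "nat \<Rightarrow> nat \<Rightarrow> nat \<Rightarrow> complex mat" where
  "matrix_unit d i j = mat d d (\<lambda>(r, s). if r = i \<and> s = j then 1 else 0)"

text \<open>
  For \<open>L\<close> from \<open>a \<times> a\<close> to \<open>b \<times> b\<close> matrices and \<open>K\<close> from \<open>c \<times> c\<close> to \<open>d \<times> d\<close> matrices, the
  tensor product of \<open>L\<close> and \<open>K\<close> is obtained by expanding its argument in the basis
  \<open>kron (matrix_unit a i j) (matrix_unit c k l)\<close>. It is the linear map determined by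
  \<open>tensor_map_kron\<close> below.
\<close>

definition tensor_map :: "nat \<Rightarrow> nat \<Rightarrow> nat \<Rightarrow> nat \<Rightarrow> mat_map \<Rightarrow> mat_map \<Rightarrow> mat_map" where
  "tensor_map a b c d L K Z = mat (b * d) (b * d) (\<lambda>(r, s).
     \<Sum>i<a. \<Sum>j<a. \<Sum>k<c. \<Sum>l<c.
       Z $$ (i * c + k, j * c + l) * kron (L (matrix_unit a i j)) (K (matrix_unit c k l)) $$ (r, s))"

primrec tensor_power :: "nat \<Rightarrow> nat \<Rightarrow> mat_map \<Rightarrow> nat \<Rightarrow> mat_map" where
  "tensor_power a b P 0 = id"
| "tensor_power a b P (Suc n) = tensor_map a b (a ^ n) (b ^ n) P (tensor_power a b P n)"

definition completely_positive :: "nat \<Rightarrow> nat \<Rightarrow> mat_map \<Rightarrow> bool" where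
  "completely_positive a b L \<longleftrightarrow> linear_mat_map a b L \<and>
     (\<forall>k\<ge>1. positive_map (k * a) (k * b) (tensor_map k k a b id L))"

definition completely_copositive :: "nat \<Rightarrow> nat \<Rightarrow> mat_map \<Rightarrow> bool" where
  "completely_copositive a b L \<longleftrightarrow> linear_mat_map a b L \<and>
     (\<forall>k\<ge>1. positive_map (k * a) (k * b) (tensor_map k k a b transpose_mat L))"

definition decomposable :: "nat \<Rightarrow> nat \<Rightarrow> mat_map \<Rightarrow> bool" where
  "decomposable a b L \<longleftrightarrow> (\<exists>T\<^sub>1 T\<^sub>2. completely_positive a b T\<^sub>1 \<and> completely_positive a b T\<^sub>2 \<and>
     (\<forall>X \<in> carrier_mat a a. L X = T\<^sub>1 X + transpose_mat (T\<^sub>2 X)))"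

definition tensor_stable_decomposable :: "nat \<Rightarrow> nat \<Rightarrow> mat_map \<Rightarrow> bool" where
  "tensor_stable_decomposable a b P \<longleftrightarrow>
     (\<forall>n\<ge>1. decomposable (a ^ n) (b ^ n) (tensor_power a b P n))"

lemma linear_mat_map_expand:
  assumes L: "linear_mat_map a b L" and X: "X \<in> carrier_mat a a" and r: "r < b" and s: "s < b"
  shows "L X $$ (r, s) = (\<Sum>i<a. \<Sum>j<a. X $$ (i, j) * L (matrix_unit a i j) $$ (r, s))"
proof -
  have cl: "\<And>Y. Y \<in> carrier_mat a a \<Longrightarrow> L Y \<in> carrier_mat b b"
    and add: "\<And>Y Z. Y \<in> carrier_mat a a \<Longrightarrow> Z \<in> carrier_mat a a \<Longrightarrow> L (Y + Z) = L Y + L Z"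
    and sc: "\<And>c Y. Y \<in> carrier_mat a a \<Longrightarrow> L (c \<cdot>\<^sub>m Y) = c \<cdot>\<^sub>m L Y"
    using L unfolding linear_mat_map_def by auto
  have E: "matrix_unit a i j \<in> carrier_mat a a" for i j
    by (simp add: matrix_unit_def)
  define part where "part S = mat a a (\<lambda>p. if p \<in> S then X $$ p else 0)" for S
  have part: "part S \<in> carrier_mat a a" for S by (simp add: part_def)
  have "L (part S) $$ (r, s) = (\<Sum>p\<in>S. X $$ p * L (matrix_unit a (fst p) (snd p)) $$ (r, s))"
    if "finite S" "S \<subseteq> {..<a} \<times> {..<a}" for S
    using that
  proof (induction S rule: finite_induct)
    case empty
    have "L (part {}) = 0 \<cdot>\<^sub>m L (part {})"
      using sc[OF part[of "{}"], of 0] by (simp add: part_def smult_mat_def map_mat_def cong: cong_mat)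
    moreover have "(0 \<cdot>\<^sub>m L (part {})) $$ (r, s) = 0"
      using cl[OF part[of "{}"]] r s by auto
    ultimately show ?case by simp
  next
    case (insert p S)
    have "part (insert p S) = part S + X $$ p \<cdot>\<^sub>m matrix_unit a (fst p) (snd p)"
      using insert.hyps insert.prems by (intro eq_matI) (auto simp: part_def matrix_unit_def)
    then have "L (part (insert p S)) = L (part S) + X $$ p \<cdot>\<^sub>m L (matrix_unit a (fst p) (snd p))"
      by (simp add: add sc part E)
    then show ?case
      using insert r s carrier_matD[OF cl[OF part[of S]]]
        carrier_matD[OF cl[OF E[of "fst p" "snd p"]]] by simp
  qed
  from this[of "{..<a} \<times> {..<a}"]
  have "L (part ({..<a} \<times> {..<a})) $$ (r, s) =
      (\<Sum>p\<in>{..<a} \<times> {..<a}. X $$ p * L (matrix_unit a (fst p) (snd p)) $$ (r, s))" by simp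
  moreover have "part ({..<a} \<times> {..<a}) = X"
    using X by (intro eq_matI) (auto simp: part_def)
  ultimately show ?thesis
    by (simp add: sum.cartesian_product split_def)
qed

lemma kron_index:
  assumes "A \<in> carrier_mat a a" "B \<in> carrier_mat c c" "r < a * c" "s < a * c"
  shows "kron A B $$ (r, s) = A $$ (r div c, s div c) * B $$ (r mod c, s mod c)"
  using assms by (auto simp: kron_def)

lemma linear_tensor_map: "linear_mat_map (a * c) (b * d) (tensor_map a b c d L K)"
proof -
  have lt: "i * c + k < a * c" if "i < a" "k < c" for i k
  proof -
    have "i * c + k < Suc i * c" using that by simp
    also have "\<dots> \<le> a * c" using that by (intro mult_le_mono1) simp
    finally show ?thesis .
  qed
  show ?thesis
    unfolding linear_mat_map_def tensor_map_def
    by (auto intro!: eq_matI sum.cong simp: lt distrib_right mult.assoc sum_distrib_left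
        simp flip: sum.distrib)
qed

lemma tensor_map_kron:
  assumes L: "linear_mat_map a b L" and K: "linear_mat_map c d K"
    and X: "X \<in> carrier_mat a a" and Y: "Y \<in> carrier_mat c c"
  shows "tensor_map a b c d L K (kron X Y) = kron (L X) (K Y)"
proof -
  have LX: "L X \<in> carrier_mat b b" and KY: "K Y \<in> carrier_mat d d"
    using L K X Y unfolding linear_mat_map_def by auto
  have LE: "L (matrix_unit a i j) \<in> carrier_mat b b" for i j
    using L unfolding linear_mat_map_def by (auto simp: matrix_unit_def)
  have KE: "K (matrix_unit c i j) \<in> carrier_mat d d" for i j
    using K unfolding linear_mat_map_def by (auto simp: matrix_unit_def)
  have lt: "i * c + k < a * c" if "i < a" "k < c" for i k
  proof -
    have "i * c + k < Suc i * c" using that by simp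
    also have "\<dots> \<le> a * c" using that by (intro mult_le_mono1) simp
    finally show ?thesis .
  qed
  show ?thesis
  proof (rule eq_matI)
    fix r s assume "r < dim_row (kron (L X) (K Y))" "s < dim_col (kron (L X) (K Y))"
    then have r: "r < b * d" and s: "s < b * d" using LX KY by (auto simp: kron_def)
    have r1: "r div d < b" and s1: "s div d < b"
      using r s by (simp_all add: less_mult_imp_div_less)
    have "0 < d" using r by (cases d) auto
    then have r2: "r mod d < d" and s2: "s mod d < d" by simp_all
    have "tensor_map a b c d L K (kron X Y) $$ (r, s) =
        (\<Sum>i<a. \<Sum>j<a. \<Sum>k<c. \<Sum>l<c.
           (X $$ (i, j) * L (matrix_unit a i j) $$ (r div d, s div d)) *
           (Y $$ (k, l) * K (matrix_unit c k l) $$ (r mod d, s mod d)))"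
      using r s by (auto simp: tensor_map_def kron_index[OF X Y] kron_index[OF LE KE] lt
          intro!: sum.cong)
    also have "\<dots> = (\<Sum>i<a. \<Sum>j<a. X $$ (i, j) * L (matrix_unit a i j) $$ (r div d, s div d)) *
        (\<Sum>k<c. \<Sum>l<c. Y $$ (k, l) * K (matrix_unit c k l) $$ (r mod d, s mod d))"
      by (simp only: sum_distrib_right) (simp only: sum_distrib_left)
    also have "\<dots> = L X $$ (r div d, s div d) * K Y $$ (r mod d, s mod d)"
      using linear_mat_map_expand[OF L X r1 s1] linear_mat_map_expand[OF K Y r2 s2] by simp
    also have "\<dots> = kron (L X) (K Y) $$ (r, s)"
      using kron_index[OF LX KY r s] by simp
    finally show "tensor_map a b c d L K (kron X Y) $$ (r, s) = kron (L X) (K Y) $$ (r, s)" .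
  qed (use LX KY in \<open>auto simp: tensor_map_def kron_def\<close>)
qed

lemma tensor_power_1:
  assumes P: "linear_mat_map a b P" and X: "X \<in> carrier_mat a a"
  shows "tensor_power a b P 1 X = P X"
proof -
  have I: "linear_mat_map 1 1 id" by (simp add: linear_mat_map_def)
  have "kron X (1\<^sub>m 1) = X" "kron (P X) (1\<^sub>m 1) = P X"
    by (auto intro!: eq_matI simp: kron_def)
  with tensor_map_kron[OF P I X, of "1\<^sub>m 1"] show ?thesis by simp
qed

end

theory Submission
  imports Defs
begin

text \<open>
  Let \<open>C\<close> be the Choi matrix of \<open>P\<close> and write \<open>\<Gamma>\<close> for the partial transposition. If
  \<open>P\<close> is neither completely positive nor completely copositive, there are vectors \<open>v\<close>, \<open>u\<close>
  such that \<open>E = v v\<^sup>*\<close> and \<open>F = (u u\<^sup>*)\<^sup>\<Gamma>\<close> satisfy \<open>tr (E C) < 0\<close> and \<open>tr (F C) < 0\<close>. For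
  large \<open>\<alpha>\<close> and \<open>\<beta>\<close> put \<open>S = \<beta> 1 + F\<close>, \<open>T = \<beta> 1 - F\<close> and
  \<open>X = \<alpha> 1 \<otimes> S \<otimes> \<dots> \<otimes> S + E \<otimes> T \<otimes> \<dots> \<otimes> T\<close>, with \<open>n\<close> factors \<open>S\<close> and \<open>T\<close>. Both \<open>X\<close>
  and \<open>X\<^sup>\<Gamma>\<close> are positive: \<open>S\<close> and \<open>T\<close> are positive, \<open>\<alpha> 1 \<plusminus> E\<^sup>\<Gamma>\<close> is positive, and so are
  \<open>S\<^sup>\<Gamma> + T\<^sup>\<Gamma> = 2 \<beta> 1\<close> and \<open>S\<^sup>\<Gamma> - T\<^sup>\<Gamma> = 2 u u\<^sup>*\<close>; the relation \<open>A \<plusminus> B \<ge> 0\<close> is preserved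
  by tensor products. Decomposability of the tensor power \<open>n + 1\<close> therefore yields
  \<open>0 \<le> \<alpha> tr C (tr (S C))\<^sup>n + tr (E C) (tr (T C))\<^sup>n\<close>, which fails for large \<open>n\<close> since
  \<open>0 \<le> tr (S C) < tr (T C)\<close> and \<open>tr (E C) < 0\<close>.
\<close>

subsection \<open>Positive semidefinite kernels\<close>

definition qform :: "'a set \<Rightarrow> ('a \<Rightarrow> 'a \<Rightarrow> complex) \<Rightarrow> ('a \<Rightarrow> complex) \<Rightarrow> complex" where
  "qform I K v = (\<Sum>p\<in>I. \<Sum>q\<in>I. cnj (v p) * K p q * v q)"

text \<open>The order on the complex numbers makes each form value real, so Hermitian symmetry is
  built in. An arbitrary index type permits pairs as indices and pullbacks along index maps.\<close>

definition psd_kernel :: "'a set \<Rightarrow> ('a \<Rightarrow> 'a \<Rightarrow> complex) \<Rightarrow> bool" where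
  "psd_kernel I K \<longleftrightarrow> (\<forall>v. 0 \<le> qform I K v)"

definition hermitian_kernel :: "'a set \<Rightarrow> ('a \<Rightarrow> 'a \<Rightarrow> complex) \<Rightarrow> bool" where
  "hermitian_kernel I K \<longleftrightarrow> (\<forall>p\<in>I. \<forall>q\<in>I. K q p = cnj (K p q))"

lemma hermitian_kernelD: "hermitian_kernel I K \<Longrightarrow> p \<in> I \<Longrightarrow> q \<in> I \<Longrightarrow> K q p = cnj (K p q)"
  unfolding hermitian_kernel_def by blast

lemma psd_kernel_cong:
  assumes "psd_kernel I K" "\<And>p q. p \<in> I \<Longrightarrow> q \<in> I \<Longrightarrow> K p q = L p q"
  shows "psd_kernel I L"
proof -
  have "qform I L v = qform I K v" for v
    unfolding qform_def using assms(2) by (intro sum.cong) auto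
  then show ?thesis using assms(1) by (simp add: psd_kernel_def)
qed

lemma psd_kernel_add:
  assumes "psd_kernel I K" "psd_kernel I L"
  shows "psd_kernel I (\<lambda>p q. K p q + L p q)"
proof -
  have "qform I (\<lambda>p q. K p q + L p q) v = qform I K v + qform I L v" for v
    by (simp add: qform_def algebra_simps sum.distrib)
  then show ?thesis using assms by (simp add: psd_kernel_def)
qed

lemma psd_kernel_scale:
  assumes "psd_kernel I K" "0 \<le> c"
  shows "psd_kernel I (\<lambda>p q. c * K p q)"
proof -
  have "qform I (\<lambda>p q. c * K p q) v = c * qform I K v" for v
    by (simp add: qform_def sum_distrib_left mult_ac)
  then show ?thesis using assms by (simp add: psd_kernel_def)
qed

lemma psd_kernel_transpose:
  assumes "psd_kernel I K"
  shows "psd_kernel I (\<lambda>p q. K q p)"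
proof -
  have "qform I (\<lambda>p q. K q p) v = qform I K (\<lambda>p. cnj (v p))" for v
    unfolding qform_def by (subst sum.swap) (simp add: mult_ac)
  then show ?thesis using assms by (simp add: psd_kernel_def)
qed

lemma psd_kernel_subset:
  assumes "finite I" "J \<subseteq> I" "psd_kernel I K"
  shows "psd_kernel J K"
  unfolding psd_kernel_def
proof
  fix v
  have "qform I K (\<lambda>p. if p \<in> J then v p else 0) = qform J K v"
    unfolding qform_def
    by (rule sum.mono_neutral_cong_right)
      (use assms in \<open>auto intro!: sum.mono_neutral_cong_right sum.neutral\<close>)
  then show "0 \<le> qform J K v" using assms(3) unfolding psd_kernel_def by metis
qed

lemma psd_kernel_diag:
  assumes "finite I" "psd_kernel I K" "p \<in> I"
  shows "0 \<le> K p p"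
proof -
  have "psd_kernel {p} K" using assms by (auto intro: psd_kernel_subset)
  then have "0 \<le> qform {p} K (\<lambda>_. 1)" unfolding psd_kernel_def by blast
  then show ?thesis by (simp add: qform_def)
qed

lemma psd_kernel_two:
  assumes "finite I" "psd_kernel I K" "p \<in> I" "q \<in> I" "p \<noteq> q"
  shows "0 \<le> cnj x * K p p * x + cnj x * K p q * y + cnj y * K q p * x + cnj y * K q q * y"
proof -
  have "psd_kernel {p, q} K" using assms by (auto intro: psd_kernel_subset)
  then have "0 \<le> qform {p, q} K (\<lambda>i. if i = p then x else y)" unfolding psd_kernel_def by blast
  then show ?thesis using assms(5) by (simp add: qform_def add.assoc)
qed

text \<open>Polarization: realness of the form at the two-point vectors \<open>(1, 1)\<close> and
  \<open>(1, \<i>)\<close> makes the imaginary parts of \<open>K p q\<close> and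
  \<open>K q p\<close> cancel and their real parts agree.\<close>

lemma psd_kernel_hermitian:
  assumes "finite I" "psd_kernel I K"
  shows "hermitian_kernel I K"
  unfolding hermitian_kernel_def
proof (intro ballI)
  fix p q assume pq: "p \<in> I" "q \<in> I"
  note d = psd_kernel_diag[OF assms pq(1)] psd_kernel_diag[OF assms pq(2)]
  show "K q p = cnj (K p q)"
  proof (cases "p = q")
    case True then show ?thesis using d by (simp add: complex_eq_iff less_eq_complex_def)
  next
    case False
    from psd_kernel_two[OF assms pq False, of 1 1] psd_kernel_two[OF assms pq False, of 1 \<i>] d
    show ?thesis by (simp add: complex_eq_iff less_eq_complex_def)
  qed
qed

text \<open>If \<open>K p p = 0\<close>, the form on vectors supported at \<open>p\<close> and
  \<open>q\<close> has no quadratic term in the coordinate at \<open>p\<close>; a nonzero linear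
  term would make it negative far out.\<close>

lemma psd_kernel_zero_diag:
  assumes "finite I" "psd_kernel I K" "p \<in> I" "q \<in> I" "K p p = 0"
  shows "K p q = 0"
proof (rule ccontr)
  assume h: "K p q \<noteq> 0"
  then have "p \<noteq> q" using assms by auto
  have h2: "K q p = cnj (K p q)"
    by (rule hermitian_kernelD[OF psd_kernel_hermitian[OF assms(1,2)] assms(3,4)])
  define m where "m = (cmod (K p q))\<^sup>2"
  \<comment> \<open>Chosen so that \<open>2 * t * m = Re (K q q) + 1\<close>, just beyond what
    positivity allows.\<close>
  define t where "t = (Re (K q q) + 1) / (2 * m)"
  have m: "m > 0" using h by (simp add: m_def)
  have mm: "K p q * cnj (K p q) = complex_of_real m"
    unfolding m_def by (rule complex_norm_square[symmetric])
  let ?x = "- complex_of_real t * K p q"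
  have "cnj ?x * K p q + cnj (K p q) * ?x = - 2 * complex_of_real t * (K p q * cnj (K p q))"
    by simp
  also have "\<dots> = - complex_of_real (2 * t * m)"
    unfolding mm by simp
  finally have "cnj ?x * K p q + cnj (K p q) * ?x = - complex_of_real (2 * t * m)" .
  moreover have "0 \<le> cnj ?x * K p q + cnj (K p q) * ?x + K q q"
    using psd_kernel_two[OF assms(1-4) \<open>p \<noteq> q\<close>, of ?x 1] unfolding h2 assms(5) by simp
  ultimately have "0 \<le> - complex_of_real (2 * t * m) + K q q" by (simp only:)
  then have "2 * t * m \<le> Re (K q q)" by (simp add: less_eq_complex_def)
  then show False using m by (simp add: t_def field_simps)
qed

section \<open>Rank-one decomposition and its consequences\<close>

lemma qform_insert:
  assumes "finite I" "a \<notin> I"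
  shows "qform (insert a I) K v = cnj (v a) * K a a * v a + cnj (v a) * (\<Sum>q\<in>I. K a q * v q)
     + (\<Sum>p\<in>I. cnj (v p) * K p a) * v a + qform I K v"
  using assms
  unfolding qform_def sum.insert[OF assms] sum.distrib
  by (simp only: sum_distrib_left sum_distrib_right mult.assoc add_ac)

text \<open>The induction step is one step of the \<open>L D L\<^sup>*\<close> factorization.\<close>

lemma psd_kernel_decomp:
  assumes "finite I" "psd_kernel I K"
  shows "\<exists>ws. \<forall>p\<in>I. \<forall>q\<in>I. K p q = (\<Sum>w\<leftarrow>ws. w p * cnj (w q))"
  using assms
proof (induction I arbitrary: K rule: finite_induct)
  case empty
  then show ?case by simp
next
  case (insert a I)
  have fin: "finite (insert a I)" using insert by simp
  have herm: "K q p = cnj (K p q)" if "p \<in> insert a I" "q \<in> insert a I" for p q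
    by (rule hermitian_kernelD[OF psd_kernel_hermitian[OF fin insert.prems] that])
  have daa: "0 \<le> K a a" using psd_kernel_diag[OF fin insert.prems] by simp
  \<comment> \<open>The induction hypothesis leaves the vectors uncontrolled at \<open>a\<close>;
    zeroing them there keeps them out of row and column \<open>a\<close>.\<close>
  have ext: "(\<Sum>w\<leftarrow>map (\<lambda>w. w(a := 0)) ws. w p * cnj (w q)) =
      (if p = a \<or> q = a then 0 else \<Sum>w\<leftarrow>ws. w p * cnj (w q))" for ws :: "('a \<Rightarrow> complex) list" and p q
    by (induction ws) auto
  show ?case
  proof (cases "K a a = 0")
    case True
    have z: "K a q = 0" "K q a = 0" if "q \<in> insert a I" for q
      using psd_kernel_zero_diag[OF fin insert.prems _ that True] herm[OF _ that, of a] by auto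
    obtain ws where ws: "\<forall>p\<in>I. \<forall>q\<in>I. K p q = (\<Sum>w\<leftarrow>ws. w p * cnj (w q))"
      using insert.IH[OF psd_kernel_subset[OF fin _ insert.prems]] by blast
    show ?thesis
      by (rule exI[of _ "map (\<lambda>w. w(a := 0)) ws"], unfold ext) (use ws z insert.hyps(2) in auto)
  next
    case False
    define d where "d = Re (K a a)"
    have d: "K a a = complex_of_real d" "d > 0"
      using daa False by (auto simp: d_def complex_eq_iff less_eq_complex_def)
    have sq: "complex_of_real (sqrt d) * complex_of_real (sqrt d) = complex_of_real d"
      using d(2) by (simp flip: of_real_mult)
    \<comment> \<open>The Schur complement of the pivot \<open>K a a\<close>.\<close>
    define L where "L p q = K p q - K p a * K a q / d" for p q
    have "psd_kernel I L"
      unfolding psd_kernel_def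
    proof
      fix v
      define s where "s = (\<Sum>q\<in>I. K a q * v q)"
      have cs: "(\<Sum>p\<in>I. cnj (v p) * K p a) = cnj s"
        unfolding s_def cnj_sum by (rule sum.cong) (simp_all add: herm[of a] mult.commute)
      have "qform I L v = qform I K v - (\<Sum>p\<in>I. cnj (v p) * K p a) * (\<Sum>q\<in>I. K a q * v q) / d"
        unfolding qform_def L_def sum_product sum_divide_distrib
        by (simp add: algebra_simps sum_subtractf)
      also have "\<dots> = qform I K v - cnj s * s / d" by (simp only: cs s_def[symmetric])
      finally have 1: "qform I L v = qform I K v - cnj s * s / d" .
      \<comment> \<open>Completing the square: this value at \<open>a\<close> minimizes the form of
        \<open>K\<close> over all extensions of \<open>v\<close>, and the minimum is the form of
        \<open>L\<close> at \<open>v\<close>.\<close>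
      define v' where "v' = v(a := - s / d)"
      have eq: "v' p = v p" if "p \<in> I" for p using that insert by (auto simp: v'_def)
      have s': "(\<Sum>q\<in>I. K a q * v' q) = s" "(\<Sum>p\<in>I. cnj (v' p) * K p a) = cnj s"
        unfolding s_def[symmetric] cs[symmetric] by (simp_all add: s_def eq)
      have q': "qform I K v' = qform I K v" by (simp add: qform_def eq)
      have "qform (insert a I) K v' = qform I L v"
        unfolding qform_insert[OF insert.hyps(1,2)] s' q' 1 using d
        by (simp add: v'_def field_simps)
      then show "0 \<le> qform I L v" using insert.prems unfolding psd_kernel_def by metis
    qed
    then obtain ws where ws: "\<forall>p\<in>I. \<forall>q\<in>I. L p q = (\<Sum>w\<leftarrow>ws. w p * cnj (w q))"
      using insert.IH by blast
    \<comment> \<open>The scaled pivot column, whose rank-one kernel is the term subtracted in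
      \<open>L\<close>.\<close>
    define w0 where "w0 p = K p a / complex_of_real (sqrt d)" for p
    have w0: "w0 p * cnj (w0 q) = K p a * K a q / d" if "q \<in> insert a I" for p q
      using herm[of q a] that by (simp add: w0_def sq)
    show ?thesis
    proof (intro exI[of _ "w0 # map (\<lambda>w. w(a := 0)) ws"] ballI)
      fix p q assume pq: "p \<in> insert a I" "q \<in> insert a I"
      show "K p q = (\<Sum>w\<leftarrow>w0 # map (\<lambda>w. w(a := 0)) ws. w p * cnj (w q))"
        unfolding list.map sum_list.Cons ext w0[OF pq(2)]
        using pq ws[rule_format, of p q] d by (cases "p = a \<or> q = a") (auto simp: L_def diff_eq_eq)
    qed
  qed
qed

text \<open>Schur product theorem. Decomposing \<open>K\<close> reduces it to rank one, where the
  entrywise product is a congruence of \<open>L\<close> by a diagonal matrix.\<close>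

lemma psd_kernel_schur:
  assumes "finite I" "psd_kernel I K" "psd_kernel I L"
  shows "psd_kernel I (\<lambda>p q. K p q * L p q)"
proof -
  obtain ws where ws: "\<And>p q. p \<in> I \<Longrightarrow> q \<in> I \<Longrightarrow> K p q = (\<Sum>w\<leftarrow>ws. w p * cnj (w q))"
    using psd_kernel_decomp[OF assms(1,2)] by metis
  have "psd_kernel I (\<lambda>p q. (\<Sum>w\<leftarrow>ws. w p * cnj (w q)) * L p q)"
  proof (induction ws)
    case Nil
    then show ?case by (simp add: psd_kernel_def qform_def)
  next
    case (Cons w ws)
    have "qform I (\<lambda>p q. w p * cnj (w q) * L p q) v = qform I L (\<lambda>q. cnj (w q) * v q)" for v
      by (simp add: qform_def mult_ac)
    then have "psd_kernel I (\<lambda>p q. w p * cnj (w q) * L p q)"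
      using assms(3) by (simp add: psd_kernel_def)
    from psd_kernel_add[OF this Cons] show ?case by (simp add: distrib_right)
  qed
  then show ?thesis by (rule psd_kernel_cong) (use ws in auto)
qed

text \<open>With the conjugate on the first argument, the pairing of this kernel with
  \<open>C\<close> is \<open>qform\<close> of \<open>C\<close> at \<open>w\<close>.\<close>

lemma psd_kernel_rank1: "psd_kernel I (\<lambda>p q. cnj (w p) * w q)"
proof -
  have "qform I (\<lambda>p q. cnj (w p) * w q) v = cnj (\<Sum>p\<in>I. w p * v p) * (\<Sum>p\<in>I. w p * v p)" for v
    by (simp add: qform_def sum_distrib_left sum_distrib_right) (subst sum.swap, simp add: mult_ac)
  moreover have "0 \<le> cnj z * z" for z
    by (simp add: less_eq_complex_def)
  ultimately show ?thesis unfolding psd_kernel_def by metis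
qed

text \<open>Rank-one summands pull back to rank-one summands, even when \<open>f\<close> sends
  several indices to one, as \<open>outer\<close> and \<open>inner\<close> do.\<close>

lemma psd_kernel_vimage:
  assumes "finite J" "psd_kernel J K" "f \<in> I \<rightarrow> J"
  shows "psd_kernel I (\<lambda>p q. K (f p) (f q))"
proof -
  obtain ws where ws: "\<And>p q. p \<in> J \<Longrightarrow> q \<in> J \<Longrightarrow> K p q = (\<Sum>w\<leftarrow>ws. w p * cnj (w q))"
    using psd_kernel_decomp[OF assms(1,2)] by metis
  have "psd_kernel I (\<lambda>p q. (\<Sum>w\<leftarrow>ws. w (f p) * cnj (w (f q))))"
  proof (induction ws)
    case Nil
    then show ?case by (simp add: psd_kernel_def qform_def)
  next
    case (Cons w ws)
    from psd_kernel_add[OF psd_kernel_rank1[of I "\<lambda>p. cnj (w (f p))"] Cons] show ?case by simp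
  qed
  then show ?thesis by (rule psd_kernel_cong) (use ws assms(3) in \<open>simp add: Pi_iff\<close>)
qed

text \<open>Test the large kernel on vectors that are constant along \<open>J\<close>.\<close>

lemma psd_kernel_marginal:
  assumes "psd_kernel (I \<times> J) K"
  shows "psd_kernel I (\<lambda>p q. \<Sum>i\<in>J. \<Sum>j\<in>J. K (p, i) (q, j))"
proof -
  have "qform I (\<lambda>p q. \<Sum>i\<in>J. \<Sum>j\<in>J. K (p, i) (q, j)) v = qform (I \<times> J) K (\<lambda>p. v (fst p))" for v
  proof -
    have "qform (I \<times> J) K (\<lambda>p. v (fst p)) =
        (\<Sum>p\<in>I. \<Sum>i\<in>J. \<Sum>q\<in>I. \<Sum>j\<in>J. cnj (v p) * K (p, i) (q, j) * v q)"
      unfolding qform_def sum.cartesian_product' by (simp only: fst_conv)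
    also have "\<dots> = (\<Sum>p\<in>I. \<Sum>q\<in>I. \<Sum>i\<in>J. \<Sum>j\<in>J. cnj (v p) * K (p, i) (q, j) * v q)"
      by (rule sum.cong[OF refl], rule sum.swap)
    finally show ?thesis by (simp only: qform_def sum_distrib_left sum_distrib_right)
  qed
  then show ?thesis using assms by (simp add: psd_kernel_def)
qed

lemma qform_hermitian_real:
  assumes "hermitian_kernel I K"
  shows "Im (qform I K v) = 0"
proof -
  have "cnj (qform I K v) = (\<Sum>p\<in>I. \<Sum>q\<in>I. cnj (v q) * K q p * v p)"
    unfolding qform_def cnj_sum
    by (intro sum.cong refl) (simp add: hermitian_kernelD[OF assms, symmetric] mult_ac)
  also have "\<dots> = qform I K v" unfolding qform_def by (rule sum.swap)
  finally show ?thesis by (simp add: complex_eq_iff)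
qed

section \<open>Domination of Hermitian kernels\<close>

definition kernel_one :: "'a \<Rightarrow> 'a \<Rightarrow> complex" where
  "kernel_one p q = (if p = q then 1 else 0)"

text \<open>In the positive semidefinite order, \<open>L\<close> lies between \<open>-K\<close> and
  \<open>K\<close>. Here \<open>L\<close> may be indefinite, as partial transposes of positive
  kernels can be.\<close>

definition dominates ::
    "'a set \<Rightarrow> ('a \<Rightarrow> 'a \<Rightarrow> complex) \<Rightarrow> ('a \<Rightarrow> 'a \<Rightarrow> complex) \<Rightarrow> bool" where
  "dominates I K L \<longleftrightarrow> psd_kernel I (\<lambda>p q. K p q + L p q) \<and> psd_kernel I (\<lambda>p q. K p q - L p q)"

lemma qform_one:
  assumes "finite I"
  shows "qform I kernel_one v = of_real (\<Sum>p\<in>I. (cmod (v p))\<^sup>2)"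
proof -
  have "qform I kernel_one v = (\<Sum>p\<in>I. \<Sum>q\<in>I. if p = q then cnj (v p) * v q else 0)"
    unfolding qform_def kernel_one_def by (intro sum.cong refl) auto
  also have "\<dots> = (\<Sum>p\<in>I. cnj (v p) * v p)"
    using assms by simp
  also have "\<dots> = of_real (\<Sum>p\<in>I. (cmod (v p))\<^sup>2)"
    unfolding of_real_sum complex_norm_square by (simp only: mult.commute)
  finally show ?thesis .
qed

lemma psd_kernel_one:
  assumes "finite I"
  shows "psd_kernel I kernel_one"
  using assms by (simp add: psd_kernel_def qform_one less_eq_complex_def sum_nonneg)

text \<open>By the arithmetic-geometric mean inequality, a product of two coordinate moduli is at
  most the squared norm. The resulting crude bound supplies the constant in
  \<open>hermitian_dominated\<close>.\<close>

lemma cmod_qform_le: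
  assumes "finite I"
  shows "cmod (qform I K v) \<le> (\<Sum>p\<in>I. \<Sum>q\<in>I. cmod (K p q)) * (\<Sum>p\<in>I. (cmod (v p))\<^sup>2)"
proof -
  define N where "N = (\<Sum>p\<in>I. (cmod (v p))\<^sup>2)"
  have le: "cmod (v p) * cmod (v q) \<le> N" if "p \<in> I" "q \<in> I" for p q
  proof -
    have "(cmod (v r))\<^sup>2 \<le> N" if "r \<in> I" for r
      unfolding N_def using that assms by (intro member_le_sum) auto
    then have "(cmod (v p))\<^sup>2 \<le> N" "(cmod (v q))\<^sup>2 \<le> N" using that by auto
    moreover have "2 * (cmod (v p) * cmod (v q)) \<le> (cmod (v p))\<^sup>2 + (cmod (v q))\<^sup>2"
      using sum_squares_bound[of "cmod (v p)" "cmod (v q)"] by simp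
    ultimately show ?thesis by linarith
  qed
  have "cmod (qform I K v) \<le> (\<Sum>p\<in>I. \<Sum>q\<in>I. cmod (cnj (v p) * K p q * v q))"
    unfolding qform_def by (rule order_trans[OF norm_sum sum_mono[OF norm_sum]])
  also have "\<dots> \<le> (\<Sum>p\<in>I. \<Sum>q\<in>I. cmod (K p q) * N)"
  proof (intro sum_mono)
    fix p q assume "p \<in> I" "q \<in> I"
    then show "cmod (cnj (v p) * K p q * v q) \<le> cmod (K p q) * N"
      using mult_left_mono[OF le, of p q "cmod (K p q)"] by (simp add: norm_mult mult_ac)
  qed
  finally show ?thesis by (simp add: N_def sum_distrib_right)
qed

lemma hermitian_dominated:
  assumes "finite I" "hermitian_kernel I K"
  obtains \<alpha> :: complex where "0 \<le> \<alpha>" "dominates I (\<lambda>p q. \<alpha> * kernel_one p q) K"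
proof
  define s where "s = (\<Sum>p\<in>I. \<Sum>q\<in>I. cmod (K p q))"
  show "0 \<le> complex_of_real s" by (simp add: s_def less_eq_complex_def sum_nonneg)
  have lin: "qform I (\<lambda>p q. of_real s * kernel_one p q + e * K p q) v
      = of_real s * qform I kernel_one v + e * qform I K v" for e v
    by (simp add: qform_def algebra_simps sum.distrib sum_distrib_left)
  have b: "0 \<le> s * (\<Sum>p\<in>I. (cmod (v p))\<^sup>2) + Re (qform I K v)"
      "0 \<le> s * (\<Sum>p\<in>I. (cmod (v p))\<^sup>2) - Re (qform I K v)" for v
    using cmod_qform_le[OF assms(1), of K v] abs_Re_le_cmod[of "qform I K v"]
    unfolding s_def by linarith+
  show "dominates I (\<lambda>p q. complex_of_real s * kernel_one p q) K"
    using lin[of 1] lin[of "-1"] b qform_hermitian_real[OF assms(2)]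
    unfolding dominates_def psd_kernel_def
    by (auto simp: qform_one[OF assms(1)] less_eq_complex_def)
qed

subsection \<open>Tensor products and partial transposition\<close>

type_synonym bikernel = "nat \<times> nat \<Rightarrow> nat \<times> nat \<Rightarrow> complex"

definition grid :: "nat \<Rightarrow> nat \<Rightarrow> (nat \<times> nat) set" where
  "grid a b = {..<a} \<times> {..<b}"

text \<open>Acts on the second tensor factor, the output side of a Choi matrix, and so corresponds
  to following a map by transposition.\<close>

definition partial_transpose :: "bikernel \<Rightarrow> bikernel" where
  "partial_transpose K p q = K (fst p, snd q) (fst q, snd p)"

text \<open>
  Under the index convention of \<^const>\<open>kron\<close>, an index of a tensor product splits into its
  quotient (first factor) and remainder (second factor).
\<close>

definition outer :: "nat \<Rightarrow> nat \<Rightarrow> nat \<times> nat \<Rightarrow> nat \<times> nat" where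
  "outer c d p = (fst p div c, snd p div d)"

definition inner :: "nat \<Rightarrow> nat \<Rightarrow> nat \<times> nat \<Rightarrow> nat \<times> nat" where
  "inner c d p = (fst p mod c, snd p mod d)"

text \<open>The Kronecker product with factors regrouped: both first components are merged into one
  index and both second components into another, so the result is again bipartite.\<close>

definition kernel_tensor :: "nat \<Rightarrow> nat \<Rightarrow> bikernel \<Rightarrow> bikernel \<Rightarrow> bikernel" where
  "kernel_tensor c d K L p q = K (outer c d p) (outer c d q) * L (inner c d p) (inner c d q)"

text \<open>The power 0 lives on a one-point grid and matches the identity on 1 by 1 matrices in
  \<open>tensor_power\<close>.\<close>

primrec kernel_power :: "nat \<Rightarrow> nat \<Rightarrow> bikernel \<Rightarrow> nat \<Rightarrow> bikernel" where
  "kernel_power a b K 0 = (\<lambda>p q. 1)"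
| "kernel_power a b K (Suc n) = kernel_tensor (a ^ n) (b ^ n) K (kernel_power a b K n)"

text \<open>This is the trace of the product of \<open>C\<close> with the transpose of \<open>X\<close>.\<close>

definition pairing :: "nat \<Rightarrow> nat \<Rightarrow> bikernel \<Rightarrow> bikernel \<Rightarrow> complex" where
  "pairing a b X C = (\<Sum>p\<in>grid a b. \<Sum>q\<in>grid a b. X p q * C p q)"

section \<open>Pairing and partial transposition on tensor products\<close>

lemma finite_grid [simp]: "finite (grid a b)"
  by (simp add: grid_def)

lemma outer_in_grid: "p \<in> grid (a * c) (b * d) \<Longrightarrow> outer c d p \<in> grid a b"
  by (auto simp: grid_def outer_def less_mult_imp_div_less)

lemma inner_in_grid: "p \<in> grid (a * c) (b * d) \<Longrightarrow> inner c d p \<in> grid c d"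
  by (cases "c = 0"; cases "d = 0") (auto simp: grid_def inner_def)

lemma digits_less:
  fixes i k a c :: nat
  assumes "i < a" "k < c"
  shows "i * c + k < a * c"
proof -
  have "i * c + k < Suc i * c" using assms by simp
  also have "\<dots> \<le> a * c" using assms by (intro mult_le_mono1) simp
  finally show ?thesis .
qed

text \<open>Division with remainder in both coordinates is a bijection from the large grid to pairs
  of points of the small grids.\<close>

lemma sum_grid_mult:
  "(\<Sum>p\<in>grid (a * c) (b * d). f (outer c d p) (inner c d p)) =
     (\<Sum>p\<in>grid a b. \<Sum>q\<in>grid c d. f p q)"
  unfolding sum.cartesian_product
  by (rule sum.reindex_bij_witness[where
        i = "\<lambda>(p, q). (fst p * c + fst q, snd p * d + snd q)" and j = "\<lambda>p. (outer c d p, inner c d p)"])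
    (auto simp: outer_in_grid inner_in_grid, auto simp: outer_def inner_def grid_def digits_less)

lemma pairing_tensor:
  "pairing (a * c) (b * d) (kernel_tensor c d K L) (kernel_tensor c d C D) =
     pairing a b K C * pairing c d L D"
proof -
  have "pairing (a * c) (b * d) (kernel_tensor c d K L) (kernel_tensor c d C D) =
      (\<Sum>p\<in>grid a b. \<Sum>p'\<in>grid c d. \<Sum>q\<in>grid a b. \<Sum>q'\<in>grid c d.
        (K p q * C p q) * (L p' q' * D p' q'))"
    unfolding pairing_def kernel_tensor_def
    using sum_grid_mult[of "\<lambda>p p'. \<Sum>q\<in>grid (a * c) (b * d).
        K p (outer c d q) * L p' (inner c d q) * (C p (outer c d q) * D p' (inner c d q))" c d a b]
      sum_grid_mult[of "\<lambda>q q'. K p q * L p' q' * (C p q * D p' q')" c d a b for p p']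
    by (simp add: mult_ac)
  also have "\<dots> = pairing a b K C * pairing c d L D"
  proof -
    have "pairing a b K C * pairing c d L D = (\<Sum>p\<in>grid a b. \<Sum>p'\<in>grid c d.
        (\<Sum>q\<in>grid a b. K p q * C p q) * (\<Sum>q'\<in>grid c d. L p' q' * D p' q'))"
      unfolding pairing_def by (rule sum_product)
    then show ?thesis by (simp only: sum_product)
  qed
  finally show ?thesis .
qed

lemma pairing_power:
  "pairing (a ^ n) (b ^ n) (kernel_power a b X n) (kernel_power a b C n) = pairing a b X C ^ n"
proof (induction n)
  case 0
  then show ?case by (simp add: pairing_def grid_def)
next
  case (Suc n)
  then show ?case by (simp add: pairing_tensor)
qed

lemma pairing_add: "pairing a b (\<lambda>p q. X p q + Y p q) C = pairing a b X C + pairing a b Y C"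
  by (simp add: pairing_def algebra_simps sum.distrib)

text \<open>Exchanging the second components of \<open>p\<close> and \<open>q\<close> is an
  involution on the summands. It allows a partial transposition to move across the pairing.\<close>

lemma pairing_partial_transpose:
  "pairing a b (partial_transpose X) (partial_transpose C) = pairing a b X C"
  unfolding pairing_def partial_transpose_def sum.cartesian_product
  by (rule sum.reindex_bij_witness[where
        i = "\<lambda>(p, q). ((fst p, snd q), (fst q, snd p))" and j = "\<lambda>(p, q). ((fst p, snd q), (fst q, snd p))"])
    (auto simp: grid_def)

lemma partial_transpose_involutive [simp]: "partial_transpose (partial_transpose K) = K"
  by (intro ext) (simp add: partial_transpose_def)

lemma partial_transpose_tensor:
  "partial_transpose (kernel_tensor c d K L) =
     kernel_tensor c d (partial_transpose K) (partial_transpose L)"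
  by (intro ext) (simp add: partial_transpose_def kernel_tensor_def outer_def inner_def)

lemma partial_transpose_power:
  "partial_transpose (kernel_power a b K n) = kernel_power a b (partial_transpose K) n"
  by (induction n) (auto simp: partial_transpose_tensor, simp add: partial_transpose_def fun_eq_iff)

lemma partial_transpose_one: "partial_transpose kernel_one = kernel_one"
  by (intro ext) (auto simp: partial_transpose_def kernel_one_def prod_eq_iff)

lemma hermitian_partial_transpose:
  assumes "hermitian_kernel (grid a b) K"
  shows "hermitian_kernel (grid a b) (partial_transpose K)"
  unfolding hermitian_kernel_def partial_transpose_def
  by (intro ballI hermitian_kernelD[OF assms]) (auto simp: grid_def)

text \<open>The tensor kernel is the Schur product of the pullbacks along \<open>outer\<close> and
  \<open>inner\<close>.\<close>

lemma psd_kernel_tensor: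
  assumes "psd_kernel (grid a b) K" "psd_kernel (grid c d) L"
  shows "psd_kernel (grid (a * c) (b * d)) (kernel_tensor c d K L)"
  unfolding kernel_tensor_def
  by (intro psd_kernel_schur psd_kernel_vimage[OF _ assms(1)] psd_kernel_vimage[OF _ assms(2)])
    (auto simp: outer_in_grid inner_in_grid)

lemma psd_kernel_power:
  assumes "psd_kernel (grid a b) K"
  shows "psd_kernel (grid (a ^ n) (b ^ n)) (kernel_power a b K n)"
proof (induction n)
  case 0
  show ?case using psd_kernel_rank1[of _ "\<lambda>_. 1"] by simp
next
  case (Suc n)
  then show ?case using psd_kernel_tensor[OF assms] by simp
qed

text \<open>With \<open>A, B = K \<plusminus> L\<close> and \<open>C, D = M \<plusminus> N\<close>,
  the sum to be shown positive is half of \<open>A \<otimes> C + B \<otimes> D\<close>, and the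
  difference is half of \<open>A \<otimes> D + B \<otimes> C\<close>.\<close>

lemma dominates_tensor:
  assumes "dominates (grid a b) K L" "dominates (grid c d) M N"
  shows "dominates (grid (a * c) (b * d)) (kernel_tensor c d K M) (kernel_tensor c d L N)"
proof -
  let ?t = "kernel_tensor c d"
  have half: "(0::complex) \<le> 1/2" by (simp add: less_eq_complex_def)
  from assms have p: "psd_kernel (grid a b) (\<lambda>p q. K p q + L p q)" (is "psd_kernel _ ?A")
      "psd_kernel (grid a b) (\<lambda>p q. K p q - L p q)" (is "psd_kernel _ ?B")
      "psd_kernel (grid c d) (\<lambda>p q. M p q + N p q)" (is "psd_kernel _ ?C")
      "psd_kernel (grid c d) (\<lambda>p q. M p q - N p q)" (is "psd_kernel _ ?D")
    by (auto simp: dominates_def)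
  have 1: "psd_kernel (grid (a * c) (b * d)) (\<lambda>p q. 1/2 * (?t ?A ?C p q + ?t ?B ?D p q))"
    by (intro psd_kernel_scale psd_kernel_add psd_kernel_tensor p half)
  have 2: "psd_kernel (grid (a * c) (b * d)) (\<lambda>p q. 1/2 * (?t ?A ?D p q + ?t ?B ?C p q))"
    by (intro psd_kernel_scale psd_kernel_add psd_kernel_tensor p half)
  show ?thesis
    unfolding dominates_def
    by (intro conjI psd_kernel_cong[OF 1] psd_kernel_cong[OF 2])
      (simp_all add: kernel_tensor_def field_simps)
qed

lemma dominates_power:
  assumes "dominates (grid a b) K L"
  shows "dominates (grid (a ^ n) (b ^ n)) (kernel_power a b K n) (kernel_power a b L n)"
proof (induction n)
  case 0
  \<comment> \<open>Both powers are the constant 1, so their sum and difference are the constants 2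
    and 0.\<close>
  show ?case
    using psd_kernel_scale[OF psd_kernel_rank1[of "grid 1 1" "\<lambda>_. 1"], of 2]
      psd_kernel_scale[OF psd_kernel_rank1[of "grid 1 1" "\<lambda>_. 1"], of 0]
    by (simp add: dominates_def less_eq_complex_def)
next
  case (Suc n)
  then show ?case using dominates_tensor[OF assms] by simp
qed

text \<open>The pairing is the form of the Schur product at the all-ones vector.\<close>

lemma pairing_nonneg:
  assumes "psd_kernel (grid a b) X" "psd_kernel (grid a b) C"
  shows "0 \<le> pairing a b X C"
proof -
  have "0 \<le> qform (grid a b) (\<lambda>p q. X p q * C p q) (\<lambda>_. 1)"
    using psd_kernel_schur[OF finite_grid assms] unfolding psd_kernel_def by blast
  then show ?thesis by (simp add: qform_def pairing_def)
qed

subsection \<open>Choi matrices\<close>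

definition choi :: "nat \<Rightarrow> mat_map \<Rightarrow> bikernel" where
  "choi a L p q = L (matrix_unit a (fst p) (fst q)) $$ (snd p, snd q)"

lemma psd_mat_iff:
  "psd_mat d A \<longleftrightarrow> A \<in> carrier_mat d d \<and> psd_kernel {..<d} (\<lambda>p q. A $$ (p, q))"
proof -
  have eq: "(A *\<^sub>v v) \<bullet>c v = qform {..<d} (\<lambda>p q. A $$ (p, q)) (\<lambda>i. v $ i)"
    if "A \<in> carrier_mat d d" "v \<in> carrier_vec d" for v
    using that unfolding qform_def
    by (auto simp: scalar_prod_def sum_distrib_right sum_distrib_left mult_ac atLeast0LessThan
        intro!: sum.cong)
  have "psd_kernel {..<d} (\<lambda>p q. A $$ (p, q))"
    if A: "A \<in> carrier_mat d d" and h: "\<forall>v\<in>carrier_vec d. 0 \<le> (A *\<^sub>v v) \<bullet>c v"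
    unfolding psd_kernel_def
  proof
    fix v
    have "0 \<le> qform {..<d} (\<lambda>p q. A $$ (p, q)) (\<lambda>i. vec d v $ i)"
      using h eq[OF A, of "vec d v"] vec_carrier[of d v] by metis
    then show "0 \<le> qform {..<d} (\<lambda>p q. A $$ (p, q)) v" by (simp add: qform_def)
  qed
  then show ?thesis using eq by (auto simp: psd_mat_def psd_kernel_def)
qed

section \<open>Choi criteria for complete positivity and copositivity\<close>

lemma matrix_unit_carrier [simp]: "matrix_unit a i j \<in> carrier_mat a a"
  by (simp add: matrix_unit_def)

lemma linear_mat_map_carrier:
  "linear_mat_map a b L \<Longrightarrow> X \<in> carrier_mat a a \<Longrightarrow> L X \<in> carrier_mat b b"
  by (simp add: linear_mat_map_def)

text \<open>Treats identity and transposition on the ancilla together: for either \<open>M\<close>,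
  a given entry receives a contribution from just one matrix unit, at
  \<open>(x0, y0)\<close>.\<close>

lemma tensor_map_delta_index:
  assumes "linear_mat_map a b L" "p < k * b" "q < k * b" "x0 < k" "y0 < k"
    and M: "\<And>x y. x < k \<Longrightarrow> y < k \<Longrightarrow> M (matrix_unit k x y) \<in> carrier_mat k k"
    and M': "\<And>x y. x < k \<Longrightarrow> y < k \<Longrightarrow>
      M (matrix_unit k x y) $$ (p div b, q div b) = (if x = x0 \<and> y = y0 then 1 else 0)"
  shows "tensor_map k k a b M L Z $$ (p, q) =
    (\<Sum>i<a. \<Sum>j<a. Z $$ (x0 * a + i, y0 * a + j) * choi a L (i, p mod b) (j, q mod b))"
proof -
  let ?c = "\<lambda>x y. \<Sum>i<a. \<Sum>j<a. Z $$ (x * a + i, y * a + j) * choi a L (i, p mod b) (j, q mod b)"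
  have "tensor_map k k a b M L Z $$ (p, q) =
      (\<Sum>x<k. \<Sum>y<k. \<Sum>i<a. \<Sum>j<a. Z $$ (x * a + i, y * a + j) *
        ((if x = x0 \<and> y = y0 then 1 else 0) * choi a L (i, p mod b) (j, q mod b)))"
    unfolding tensor_map_def index_mat(1)[OF assms(2,3)] prod.case
    by (intro sum.cong refl)
      (simp add: kron_index[OF M linear_mat_map_carrier[OF assms(1) matrix_unit_carrier] assms(2,3)]
        M' choi_def)
  also have "\<dots> = (\<Sum>x<k. \<Sum>y<k. if x = x0 \<and> y = y0 then ?c x y else 0)"
    by (intro sum.cong refl) auto
  also have "\<dots> = (\<Sum>x<k. if x = x0 then \<Sum>y<k. if y = y0 then ?c x y else 0 else 0)"
    by (intro sum.cong refl) auto
  also have "\<dots> = ?c x0 y0"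
    using assms(4,5) by simp
  finally show ?thesis .
qed

lemma tensor_map_id_index:
  assumes "linear_mat_map a b L" "p < k * b" "q < k * b"
  shows "tensor_map k k a b id L Z $$ (p, q) =
    (\<Sum>i<a. \<Sum>j<a. Z $$ (p div b * a + i, q div b * a + j) * choi a L (i, p mod b) (j, q mod b))"
  by (rule tensor_map_delta_index[OF assms])
    (use assms(2,3) in \<open>auto simp: less_mult_imp_div_less matrix_unit_def\<close>)

lemma tensor_map_transpose_index:
  assumes "linear_mat_map a b L" "p < k * b" "q < k * b"
  shows "tensor_map k k a b transpose_mat L Z $$ (p, q) =
    (\<Sum>i<a. \<Sum>j<a. Z $$ (q div b * a + i, p div b * a + j) * choi a L (i, p mod b) (j, q mod b))"
  by (rule tensor_map_delta_index[OF assms])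
    (use assms(2,3) in \<open>auto simp: less_mult_imp_div_less matrix_unit_def\<close>)

text \<open>Before summation the terms form a Schur product of pullbacks of \<open>Z\<close> and
  \<open>D\<close>, indexed by an output index together with a summation index; the sums are its
  marginal.\<close>

lemma psd_kernel_contract:
  assumes "psd_kernel {..<k * a} Z" "psd_kernel (grid a b) D"
  shows "psd_kernel {..<k * b} (\<lambda>p q. \<Sum>i<a. \<Sum>j<a.
    Z (p div b * a + i) (q div b * a + j) * D (i, p mod b) (j, q mod b))"
proof -
  have "psd_kernel ({..<k * b} \<times> {..<a}) (\<lambda>p q.
      Z (fst p div b * a + snd p) (fst q div b * a + snd q) *
      D (snd p, fst p mod b) (snd q, fst q mod b))"
  proof (rule psd_kernel_schur)
    show "psd_kernel ({..<k * b} \<times> {..<a})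
        (\<lambda>p q. Z (fst p div b * a + snd p) (fst q div b * a + snd q))"
      by (rule psd_kernel_vimage[OF _ assms(1)])
        (auto simp: digits_less less_mult_imp_div_less)
    have "p mod b < b" if "p < k * b" for p using that by (cases "b = 0") auto
    then show "psd_kernel ({..<k * b} \<times> {..<a})
        (\<lambda>p q. D (snd p, fst p mod b) (snd q, fst q mod b))"
      by (intro psd_kernel_vimage[OF _ assms(2), where f = "\<lambda>p. (snd p, fst p mod b)"])
        (auto simp: grid_def)
  qed auto
  from psd_kernel_marginal[OF this] show ?thesis by simp
qed

lemma tensor_map_carrier: "tensor_map a b c d L K Z \<in> carrier_mat (b * d) (b * d)"
  by (simp add: tensor_map_def)

lemma completely_positive_if_psd_choi:
  assumes "linear_mat_map a b L" "psd_kernel (grid a b) (choi a L)"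
  shows "completely_positive a b L"
  unfolding completely_positive_def positive_map_def
proof (intro conjI allI impI assms(1) linear_tensor_map)
  fix k Z assume "psd_mat (k * a) Z"
  then have Z: "psd_kernel {..<k * a} (\<lambda>p q. Z $$ (p, q))" by (simp add: psd_mat_iff)
  show "psd_mat (k * b) (tensor_map k k a b id L Z)"
    unfolding psd_mat_iff
    by (intro conjI tensor_map_carrier psd_kernel_cong[OF psd_kernel_contract[OF Z assms(2)]])
      (simp add: tensor_map_id_index[OF assms(1)])
qed

lemma completely_copositive_if_psd_choi:
  assumes "linear_mat_map a b L" "psd_kernel (grid a b) (partial_transpose (choi a L))"
  shows "completely_copositive a b L"
  unfolding completely_copositive_def positive_map_def
proof (intro conjI allI impI assms(1) linear_tensor_map)
  fix k Z assume "psd_mat (k * a) Z"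
  then have Z: "psd_kernel {..<k * a} (\<lambda>p q. Z $$ (p, q))" by (simp add: psd_mat_iff)
  \<comment> \<open>Transposing the whole contraction swaps the ancilla indices and undoes the
    partial transposition of the Choi kernel, which gives the formula in
    \<open>tensor_map_transpose_index\<close>.\<close>
  note psd = psd_kernel_transpose[OF psd_kernel_contract[OF Z assms(2)]]
  show "psd_mat (k * b) (tensor_map k k a b transpose_mat L Z)"
    unfolding psd_mat_iff
    by (intro conjI tensor_map_carrier psd_kernel_cong[OF psd])
      (simp add: tensor_map_transpose_index[OF assms(1)] partial_transpose_def)
qed

lemma completely_positive_psd_choi:
  assumes "completely_positive a b L" "a \<ge> 1"
  shows "psd_kernel (grid a b) (choi a L)"
proof -
  have L: "linear_mat_map a b L" and pos: "positive_map (a * a) (a * b) (tensor_map a a a b id L)"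
    using assms by (auto simp: completely_positive_def)
  \<comment> \<open>The unnormalized maximally entangled vector in flattened indices; the ancilla
    has the input dimension \<open>a\<close>, and the image of its projector \<open>Z\<close> lists
    the Choi kernel.\<close>
  define w :: "nat \<Rightarrow> complex" where "w p = (if p div a = p mod a then 1 else 0)" for p
  define Z where "Z = mat (a * a) (a * a) (\<lambda>(p, q). cnj (w p) * w q)"
  have "psd_mat (a * a) Z"
    unfolding psd_mat_iff Z_def
    by (auto intro: psd_kernel_cong[OF psd_kernel_rank1[of _ w]])
  then have "psd_mat (a * b) (tensor_map a a a b id L Z)"
    using pos by (simp add: positive_map_def)
  then have psd: "psd_kernel {..<a * b} (\<lambda>p q. tensor_map a a a b id L Z $$ (p, q))"
    by (simp add: psd_mat_iff)
  have wi: "w (x * a + i) = (if x = i then 1 else 0)" if "i < a" for x i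
    using that by (auto simp: w_def)
  have entry: "tensor_map a a a b id L Z $$ (x * b + r, y * b + s) = choi a L (x, r) (y, s)"
    if "x < a" "y < a" "r < b" "s < b" for x y r s
  proof -
    have "tensor_map a a a b id L Z $$ (x * b + r, y * b + s) =
        (\<Sum>i<a. \<Sum>j<a. Z $$ (x * a + i, y * a + j) * choi a L (i, r) (j, s))"
      using that by (subst tensor_map_id_index[OF L]) (auto simp: digits_less)
    also have "\<dots> = (\<Sum>i<a. \<Sum>j<a. if i = x then if j = y then choi a L (i, r) (j, s) else 0 else 0)"
      using that by (intro sum.cong refl) (auto simp: Z_def digits_less wi)
    also have "\<dots> = (\<Sum>i<a. if i = x then \<Sum>j<a. if j = y then choi a L (i, r) (j, s) else 0 else 0)"
      by (intro sum.cong refl) auto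
    also have "\<dots> = choi a L (x, r) (y, s)" using that by simp
    finally show ?thesis .
  qed
  have "psd_kernel (grid a b) (\<lambda>p q.
      tensor_map a a a b id L Z $$ (fst p * b + snd p, fst q * b + snd q))"
    by (rule psd_kernel_vimage[OF _ psd]) (auto simp: grid_def digits_less)
  then show ?thesis
    by (rule psd_kernel_cong) (auto simp: grid_def entry)
qed

section \<open>Choi kernels of decomposable maps\<close>

lemma decomposable_choi:
  assumes "decomposable a b L" "a \<ge> 1"
  obtains A B where "psd_kernel (grid a b) A" "psd_kernel (grid a b) B"
    "\<And>p q. p \<in> grid a b \<Longrightarrow> q \<in> grid a b \<Longrightarrow> choi a L p q = A p q + partial_transpose B p q"
proof -
  obtain T U where TU: "completely_positive a b T" "completely_positive a b U"
    and eq: "\<forall>X\<in>carrier_mat a a. L X = T X + transpose_mat (U X)"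
    using assms(1) by (auto simp: decomposable_def)
  have c: "T (matrix_unit a i j) \<in> carrier_mat b b" "U (matrix_unit a i j) \<in> carrier_mat b b" for i j
    using TU by (auto simp: completely_positive_def intro: linear_mat_map_carrier)
  show ?thesis
    by (rule that[OF completely_positive_psd_choi[OF TU(1) assms(2)]
          completely_positive_psd_choi[OF TU(2) assms(2)]])
      (use carrier_matD[OF c(1)] carrier_matD[OF c(2)] in
        \<open>auto simp: choi_def eq partial_transpose_def grid_def\<close>)
qed

lemma pairing_cong:
  assumes "\<And>p q. p \<in> grid a b \<Longrightarrow> q \<in> grid a b \<Longrightarrow> C p q = D p q"
  shows "pairing a b X C = pairing a b X D"
  unfolding pairing_def using assms by (intro sum.cong) auto

text \<open>The Choi kernel is a positive kernel plus the partial transpose of a positive kernel. In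
  the second term the transposition moves onto \<open>X\<close>.\<close>

lemma decomposable_pairing_nonneg:
  assumes "decomposable a b L" "a \<ge> 1"
    "psd_kernel (grid a b) X" "psd_kernel (grid a b) (partial_transpose X)"
  shows "0 \<le> pairing a b X (choi a L)"
proof -
  obtain A B where AB: "psd_kernel (grid a b) A" "psd_kernel (grid a b) B"
    "\<And>p q. p \<in> grid a b \<Longrightarrow> q \<in> grid a b \<Longrightarrow> choi a L p q = A p q + partial_transpose B p q"
    using decomposable_choi[OF assms(1,2)] by metis
  have "pairing a b X (choi a L) = pairing a b X (\<lambda>p q. A p q + partial_transpose B p q)"
    by (rule pairing_cong[OF AB(3)])
  also have "\<dots> = pairing a b X A + pairing a b X (partial_transpose B)"
    by (simp add: pairing_def algebra_simps sum.distrib)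
  also have "pairing a b X (partial_transpose B) = pairing a b (partial_transpose X) B"
    using pairing_partial_transpose[of a b "partial_transpose X" B] by simp
  finally show ?thesis
    using pairing_nonneg[OF assms(3) AB(1)] pairing_nonneg[OF assms(4) AB(2)] by simp
qed

lemma hermitian_choi_decomposable:
  assumes "decomposable a b L" "a \<ge> 1"
  shows "hermitian_kernel (grid a b) (choi a L)"
proof -
  obtain A B where AB: "psd_kernel (grid a b) A" "psd_kernel (grid a b) B"
    "\<And>p q. p \<in> grid a b \<Longrightarrow> q \<in> grid a b \<Longrightarrow> choi a L p q = A p q + partial_transpose B p q"
    using decomposable_choi[OF assms(1,2)] by metis
  note herm = psd_kernel_hermitian[OF finite_grid AB(1)]
    hermitian_partial_transpose[OF psd_kernel_hermitian[OF finite_grid AB(2)]]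
  show ?thesis
    unfolding hermitian_kernel_def
  proof (intro ballI)
    fix p q assume pq: "p \<in> grid a b" "q \<in> grid a b"
    show "choi a L q p = cnj (choi a L p q)"
      using hermitian_kernelD[OF herm(1) pq] hermitian_kernelD[OF herm(2) pq]
      by (simp only: AB(3) pq complex_cnj_add)
  qed
qed

section \<open>Choi kernels of tensor powers\<close>

lemma linear_tensor_power:
  "linear_mat_map (a ^ n) (b ^ n) (tensor_power a b P n)"
  by (cases n) (simp_all add: linear_tensor_map, simp add: linear_mat_map_def)

lemma kron_matrix_unit:
  assumes "i < a" "j < a" "k < c" "l < c"
  shows "kron (matrix_unit a i j) (matrix_unit c k l) = matrix_unit (a * c) (i * c + k) (j * c + l)"
proof (rule eq_matI)
  fix r s assume "r < dim_row (matrix_unit (a * c) (i * c + k) (j * c + l))"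
    "s < dim_col (matrix_unit (a * c) (i * c + k) (j * c + l))"
  then have rs: "r < a * c" "s < a * c" by (auto simp: matrix_unit_def)
  have eq: "x = y * c + z \<longleftrightarrow> x div c = y \<and> x mod c = z" if "z < c" for x y z
    using that by auto
  from rs assms have "r div c < a" "s div c < a" "r mod c < c" "s mod c < c"
    by (auto simp: less_mult_imp_div_less)
  then show "kron (matrix_unit a i j) (matrix_unit c k l) $$ (r, s) =
      matrix_unit (a * c) (i * c + k) (j * c + l) $$ (r, s)"
    using rs assms by (simp add: kron_index[of _ a _ c]) (auto simp: matrix_unit_def eq)
qed (auto simp: kron_def matrix_unit_def)

text \<open>A matrix unit at composite indices is the \<open>kron\<close> of matrix units at their
  digits, and \<open>tensor_map\<close> respects \<open>kron\<close>.\<close>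

lemma choi_tensor_map:
  assumes L: "linear_mat_map a b L" and K: "linear_mat_map c d K"
    and p: "p \<in> grid (a * c) (b * d)" and q: "q \<in> grid (a * c) (b * d)"
  shows "choi (a * c) (tensor_map a b c d L K) p q = kernel_tensor c d (choi a L) (choi c K) p q"
proof -
  have in_o: "outer c d p \<in> grid a b" "outer c d q \<in> grid a b"
    and in_i: "inner c d p \<in> grid c d" "inner c d q \<in> grid c d"
    using p q by (auto simp: outer_in_grid inner_in_grid)
  have "matrix_unit (a * c) (fst p) (fst q) =
      kron (matrix_unit a (fst p div c) (fst q div c)) (matrix_unit c (fst p mod c) (fst q mod c))"
    using in_o in_i by (subst kron_matrix_unit) (auto simp: grid_def outer_def inner_def)
  then have "choi (a * c) (tensor_map a b c d L K) p q =
      kron (L (matrix_unit a (fst p div c) (fst q div c)))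
        (K (matrix_unit c (fst p mod c) (fst q mod c))) $$ (snd p, snd q)"
    by (simp add: choi_def tensor_map_kron[OF L K])
  also have "\<dots> = kernel_tensor c d (choi a L) (choi c K) p q"
    using p q by (subst kron_index[OF linear_mat_map_carrier[OF L] linear_mat_map_carrier[OF K]])
      (auto simp: kernel_tensor_def choi_def outer_def inner_def grid_def)
  finally show ?thesis .
qed

lemma choi_tensor_power:
  assumes P: "linear_mat_map a b P"
    and "p \<in> grid (a ^ n) (b ^ n)" "q \<in> grid (a ^ n) (b ^ n)"
  shows "choi (a ^ n) (tensor_power a b P n) p q = kernel_power a b (choi a P) n p q"
  using assms(2,3)
proof (induction n arbitrary: p q)
  case 0
  then show ?case by (cases p; cases q) (simp add: choi_def grid_def matrix_unit_def)
next
  case (Suc n)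
  then have g: "p \<in> grid (a * a ^ n) (b * b ^ n)" "q \<in> grid (a * a ^ n) (b * b ^ n)" by auto
  show ?case
    using choi_tensor_map[OF P linear_tensor_power g] Suc.IH inner_in_grid[OF g(1)] inner_in_grid[OF g(2)]
    by (simp add: kernel_tensor_def)
qed

lemma not_psd_kernelE:
  assumes "finite I" "hermitian_kernel I K" "\<not> psd_kernel I K"
  obtains v where "Re (qform I K v) < 0"
  using assms(3) qform_hermitian_real[OF assms(2)]
  by (auto simp: psd_kernel_def less_eq_complex_def not_le)

subsection \<open>Tensor-stable decomposable maps\<close>

theorem theorem1p1:
  fixes d\<^sub>A d\<^sub>B :: nat and P :: mat_map
  assumes "d\<^sub>A \<ge> 1" and "d\<^sub>B \<ge> 1"
    and "linear_mat_map d\<^sub>A d\<^sub>B P"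
    and "tensor_stable_decomposable d\<^sub>A d\<^sub>B P"
  shows "completely_positive d\<^sub>A d\<^sub>B P \<or> completely_copositive d\<^sub>A d\<^sub>B P"
proof (rule ccontr)
  assume neg: "\<not> ?thesis"
  let ?G = "grid d\<^sub>A d\<^sub>B" and ?pt = partial_transpose
  define C where "C = choi d\<^sub>A P"
  \<comment> \<open>Tensor stability enters through this inequality and, for one factor, through
    Hermiticity of \<open>C\<close>.\<close>
  have nonneg: "0 \<le> pairing (d\<^sub>A ^ n) (d\<^sub>B ^ n) X (kernel_power d\<^sub>A d\<^sub>B C n)"
    if "n \<ge> 1" "psd_kernel (grid (d\<^sub>A ^ n) (d\<^sub>B ^ n)) X"
      "psd_kernel (grid (d\<^sub>A ^ n) (d\<^sub>B ^ n)) (?pt X)" for n X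
  proof -
    have "decomposable (d\<^sub>A ^ n) (d\<^sub>B ^ n) (tensor_power d\<^sub>A d\<^sub>B P n)"
      using assms(4) that(1) by (simp add: tensor_stable_decomposable_def)
    from decomposable_pairing_nonneg[OF this _ that(2,3)] assms(1)
    have "0 \<le> pairing (d\<^sub>A ^ n) (d\<^sub>B ^ n) X (choi (d\<^sub>A ^ n) (tensor_power d\<^sub>A d\<^sub>B P n))" by simp
    also have "\<dots> = pairing (d\<^sub>A ^ n) (d\<^sub>B ^ n) X (kernel_power d\<^sub>A d\<^sub>B C n)"
      unfolding C_def by (rule pairing_cong[OF choi_tensor_power[OF assms(3)]])
    finally show ?thesis .
  qed
  have one: "kernel_power d\<^sub>A d\<^sub>B K 1 = K" for K
    by (intro ext) (simp add: kernel_tensor_def outer_def)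
  have nonneg1: "0 \<le> pairing d\<^sub>A d\<^sub>B X C" if "psd_kernel ?G X" "psd_kernel ?G (?pt X)" for X
    using nonneg[of 1 X] that unfolding one by simp
  \<comment> \<open>Hermiticity makes the forms of \<open>C\<close> and \<open>?pt C\<close> real,
    so failure of positivity yields a strictly negative value.\<close>
  have herm: "hermitian_kernel ?G C"
  proof -
    have "decomposable (d\<^sub>A ^ 1) (d\<^sub>B ^ 1) (tensor_power d\<^sub>A d\<^sub>B P 1)"
      using assms(4) unfolding tensor_stable_decomposable_def by blast
    from hermitian_choi_decomposable[OF this] assms(1)
    have "hermitian_kernel ?G (choi (d\<^sub>A ^ 1) (tensor_power d\<^sub>A d\<^sub>B P 1))" by simp
    moreover have "choi (d\<^sub>A ^ 1) (tensor_power d\<^sub>A d\<^sub>B P 1) p q = C p q" if "p \<in> ?G" "q \<in> ?G" for p q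
      using choi_tensor_power[OF assms(3), of p 1 q] that unfolding one by (simp add: C_def)
    ultimately show ?thesis
      unfolding hermitian_kernel_def by metis
  qed
  obtain v where v: "Re (qform ?G C v) < 0"
    using not_psd_kernelE[OF finite_grid herm] neg
      completely_positive_if_psd_choi[OF assms(3)] by (auto simp: C_def)
  obtain u where u: "Re (qform ?G (?pt C) u) < 0"
    using not_psd_kernelE[OF finite_grid hermitian_partial_transpose[OF herm]] neg
      completely_copositive_if_psd_choi[OF assms(3)] by (auto simp: C_def)
  define E :: bikernel where "E p q = cnj (v p) * v q" for p q
  define \<Phi> :: bikernel where "\<Phi> p q = cnj (u p) * u q" for p q
  define F where "F = ?pt \<Phi>"
  have psdE: "psd_kernel ?G E" and psd\<Phi>: "psd_kernel ?G \<Phi>"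
    unfolding E_def[abs_def] \<Phi>_def[abs_def] by (rule psd_kernel_rank1)+
  have EC: "Re (pairing d\<^sub>A d\<^sub>B E C) < 0"
    using v by (simp add: pairing_def qform_def E_def mult_ac)
  have FC: "Re (pairing d\<^sub>A d\<^sub>B F C) < 0"
    using u pairing_partial_transpose[of d\<^sub>A d\<^sub>B \<Phi> "?pt C"]
    by (simp add: F_def) (simp add: pairing_def qform_def \<Phi>_def mult_ac)
  have hF: "hermitian_kernel ?G F" and hE: "hermitian_kernel ?G (?pt E)"
    unfolding F_def using psdE psd\<Phi> by (auto intro!: hermitian_partial_transpose psd_kernel_hermitian)
  obtain \<beta> where \<beta>: "0 \<le> \<beta>" "dominates ?G (\<lambda>p q. \<beta> * kernel_one p q) F"
    using hermitian_dominated[OF finite_grid hF] .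
  \<comment> \<open>The bound is fitted to \<open>?pt E\<close>, which may be indefinite, while
    \<open>E\<close> itself is positive.\<close>
  obtain \<alpha> where \<alpha>: "0 \<le> \<alpha>" "dominates ?G (\<lambda>p q. \<alpha> * kernel_one p q) (?pt E)"
    using hermitian_dominated[OF finite_grid hE] .
  define K :: bikernel where "K p q = \<alpha> * kernel_one p q" for p q
  define S where "S p q = \<beta> * kernel_one p q + F p q" for p q
  define T where "T p q = \<beta> * kernel_one p q - F p q" for p q
  have psdS: "psd_kernel ?G S" and psdT: "psd_kernel ?G T"
    using \<beta>(2) by (simp_all add: dominates_def S_def[abs_def] T_def[abs_def])
  have psdK: "psd_kernel ?G K"
    unfolding K_def[abs_def] by (intro psd_kernel_scale psd_kernel_one \<alpha>(1)) simp
  have ptK: "?pt K = K"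
    using partial_transpose_one by (simp add: K_def partial_transpose_def fun_eq_iff)
  have ptS: "?pt S p q = \<beta> * kernel_one p q + \<Phi> p q"
    and ptT: "?pt T p q = \<beta> * kernel_one p q - \<Phi> p q" for p q
    using fun_cong[OF fun_cong[OF partial_transpose_one]]
    by (simp_all add: S_def T_def F_def partial_transpose_def)
  have domST: "dominates ?G (?pt S) (?pt T)"
  proof -
    have "psd_kernel ?G (\<lambda>p q. (2 * \<beta>) * kernel_one p q)"
      using \<beta>(1) by (intro psd_kernel_scale psd_kernel_one) (auto simp: less_eq_complex_def)
    moreover have "psd_kernel ?G (\<lambda>p q. 2 * \<Phi> p q)"
      by (intro psd_kernel_scale psd\<Phi>) (simp add: less_eq_complex_def)
    ultimately show ?thesis by (simp add: dominates_def ptS ptT algebra_simps)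
  qed
  \<comment> \<open>With \<open>psdS\<close>, this lets \<open>nonneg1\<close> apply to
    \<open>S\<close>, whence \<open>0 \<le> \<sigma>\<close>.\<close>
  have psdptS: "psd_kernel ?G (?pt S)"
    unfolding ptS[abs_def] using \<beta>(1)
    by (intro psd_kernel_add psd_kernel_scale psd_kernel_one psd\<Phi>) auto

  define e where "e = - Re (pairing d\<^sub>A d\<^sub>B E C)"
  define c where "c = Re (pairing d\<^sub>A d\<^sub>B K C)"
  define \<sigma> where "\<sigma> = Re (pairing d\<^sub>A d\<^sub>B S C)"
  define \<tau> where "\<tau> = Re (pairing d\<^sub>A d\<^sub>B T C)"
  have S0: "0 \<le> pairing d\<^sub>A d\<^sub>B S C" by (rule nonneg1[OF psdS psdptS])
  \<comment> \<open>Since \<open>T = S - 2 F\<close> and \<open>F\<close> pairs negatively with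
    \<open>C\<close>, this gives \<open>\<sigma> < \<tau>\<close>.\<close>
  have diff: "pairing d\<^sub>A d\<^sub>B T C = pairing d\<^sub>A d\<^sub>B S C - 2 * pairing d\<^sub>A d\<^sub>B F C"
    by (simp add: pairing_def S_def T_def algebra_simps sum.distrib sum_subtractf sum_distrib_left)
  have "Im (pairing d\<^sub>A d\<^sub>B F C) = 0"
  proof -
    have "hermitian_kernel ?G (\<lambda>p q. F p q * C p q)"
      unfolding hermitian_kernel_def complex_cnj_mult
      by (intro ballI arg_cong2[of _ _ _ _ "(*)"] hermitian_kernelD[OF hF] hermitian_kernelD[OF herm])
    from qform_hermitian_real[OF this, of "\<lambda>_. 1"] show ?thesis
      by (simp add: qform_def pairing_def)
  qed
  with S0 diff have real: "pairing d\<^sub>A d\<^sub>B S C = of_real \<sigma>" "pairing d\<^sub>A d\<^sub>B T C = of_real \<tau>"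
    by (auto simp: complex_eq_iff \<sigma>_def \<tau>_def less_eq_complex_def)
  have \<sigma>\<tau>: "0 \<le> \<sigma>" "\<sigma> < \<tau>"
    using S0 diff FC by (auto simp: \<sigma>_def \<tau>_def less_eq_complex_def)
  have main: "e * \<tau> ^ n \<le> c * \<sigma> ^ n" for n
  proof -
    let ?t = "kernel_tensor (d\<^sub>A ^ n) (d\<^sub>B ^ n)" and ?p = "\<lambda>K. kernel_power d\<^sub>A d\<^sub>B K n"
    let ?X = "\<lambda>p q. ?t K (?p S) p q + ?t E (?p T) p q"
    \<comment> \<open>Domination handles only the partial transpose of \<open>?X\<close>;
      \<open>?X\<close> itself is a sum of tensor products of positive kernels.\<close>
    have "dominates (grid (d\<^sub>A * d\<^sub>A ^ n) (d\<^sub>B * d\<^sub>B ^ n)) (?t K (?p (?pt S))) (?t (?pt E) (?p (?pt T)))"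
      using dominates_tensor[OF \<alpha>(2) dominates_power[OF domST]] by (simp add: K_def[abs_def])
    moreover have "?pt ?X = (\<lambda>p q. ?t K (?p (?pt S)) p q + ?t (?pt E) (?p (?pt T)) p q)"
    proof -
      have "?pt ?X = (\<lambda>p q. ?pt (?t K (?p S)) p q + ?pt (?t E (?p T)) p q)"
        by (simp add: partial_transpose_def fun_eq_iff)
      then show ?thesis by (simp only: partial_transpose_tensor partial_transpose_power ptK)
    qed
    ultimately have "psd_kernel (grid (d\<^sub>A ^ Suc n) (d\<^sub>B ^ Suc n)) (?pt ?X)"
      by (simp add: dominates_def)
    moreover have "psd_kernel (grid (d\<^sub>A ^ Suc n) (d\<^sub>B ^ Suc n)) ?X"
      unfolding power_Suc
      by (intro psd_kernel_add psd_kernel_tensor psd_kernel_power psdK psdE psdS psdT)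
    ultimately have "0 \<le> pairing (d\<^sub>A ^ Suc n) (d\<^sub>B ^ Suc n) ?X (kernel_power d\<^sub>A d\<^sub>B C (Suc n))"
      by (intro nonneg) auto
    also have "\<dots> = pairing d\<^sub>A d\<^sub>B K C * of_real (\<sigma> ^ n) + pairing d\<^sub>A d\<^sub>B E C * of_real (\<tau> ^ n)"
      by (simp add: pairing_add pairing_tensor pairing_power real)
    finally show ?thesis by (simp add: less_eq_complex_def e_def c_def del: of_real_power)
  qed
  \<comment> \<open>Dividing \<open>main\<close> by \<open>\<tau> ^ n\<close> bounds the positive
    constant \<open>e\<close> by a sequence tending to 0, as
    \<open>0 \<le> \<sigma> < \<tau>\<close>.\<close>
  have "(\<lambda>n. c * (\<sigma> / \<tau>) ^ n) \<longlonglongrightarrow> c * 0"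
    using \<sigma>\<tau> by (intro tendsto_mult tendsto_const LIMSEQ_power_zero) auto
  moreover have "e \<le> c * (\<sigma> / \<tau>) ^ n" for n
    using main[of n] \<sigma>\<tau> by (simp add: power_divide field_simps)
  ultimately have "e \<le> c * 0" by (intro LIMSEQ_le_const) auto
  then show False using EC by (simp add: e_def)
qed

end
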